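(* Let $\mathcal{P}\subseteq\{0,1\}^{\mathbb{N}}$ be a $\Pi^0_1$ class with $\lambda(\mathcal{P})>0$. Then every Martin-Löf random $Z\in\{0,1\}^{\mathbb{N}}$ is multiply recurrent in $\mathcal{P}$, i.e. for every $k\ge1$ there is $n\ge1$ such that $T^{ni}(Z)\in\mathcal{P}$ for all $1\le i\le k$.
   Context: Cantor space $\{0,1\}^{\mathbb{N}}$ carries the uniform (product) measure $\lambda$. $T$ is the shift, deleting the first bit of a sequence. A $\Sigma^0_1$ class is a set $\{Y:\exists\sigma\in S,\ \sigma\prec Y\}$ for a computably enumerable set $S$ of finite binary strings; a $\Pi^0_1$ class is the complement of a $\Sigma^0_1$ class. A Martin-Löf test is a uniformly computably enumerable sequence $(U_m)_{m\in\mathbb{N}}$ of $\Sigma^0_1$ classes with $\lambda(U_m)\le2^{-m}$; $Z$ is Martin-Löf random if $Z\notin\bigcap_m U_m$ for every Martin-Löf test. $Z$ is $k$-recurrent in $\mathcal{P}$ if there is $n\ge1$ with $Z\in\bigcap_{1\le i\le k}T^{-ni}(\mathcal{P})$; multiply recurrent if $k$-recurrent for all $k\ge1$. *)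

theory Defs
  imports "HOL-Probability.Probability" "HOL-Library.Nat_Bijection"
begin

text \<open>
  Total recursive functions in the style of Kleene, where minimization is applied to regular
  functions only. A function of arity \<open>n\<close> is represented by its values on lists of length \<open>n\<close>;
  the values on other lists are irrelevant.
\<close>

inductive recursive :: "nat \<Rightarrow> (nat list \<Rightarrow> nat) \<Rightarrow> bool" where
  zero: "recursive n (\<lambda>xs. 0)"
| succ: "recursive 1 (\<lambda>xs. Suc (xs ! 0))"
| proj: "i < n \<Longrightarrow> recursive n (\<lambda>xs. xs ! i)"
| comp: "recursive (length fs) g \<Longrightarrow> (\<forall>f\<in>set fs. recursive n f) \<Longrightarrow>
    recursive n (\<lambda>xs. g (map (\<lambda>f. f xs) fs))"
| prec: "recursive n g \<Longrightarrow> recursive (Suc (Suc n)) h \<Longrightarrow>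
    recursive (Suc n) (\<lambda>xs. rec_nat (g (tl xs)) (\<lambda>y r. h (y # r # tl xs)) (hd xs))"
| mini: "recursive (Suc n) f \<Longrightarrow> (\<forall>xs. length xs = n \<longrightarrow> (\<exists>y. f (y # xs) = 0)) \<Longrightarrow>
    recursive n (\<lambda>xs. LEAST y. f (y # xs) = 0)"

definition computable :: "(nat \<Rightarrow> nat) \<Rightarrow> bool" where
  "computable f \<longleftrightarrow> (\<exists>g. recursive 1 g \<and> (\<forall>x. f x = g [x]))"

definition comp_enum :: "nat set \<Rightarrow> bool" where
  "comp_enum A \<longleftrightarrow> A = {} \<or> (\<exists>f. computable f \<and> A = range f)"

text \<open>
  Finite binary strings are identified with natural numbers by bijective base-2 numeration,
  the first bit being the least significant digit (digit 1 for \<open>False\<close>, digit 2 for \<open>True\<close>).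
\<close>

primrec string_code :: "bool list \<Rightarrow> nat" where
  "string_code [] = 0"
| "string_code (b # \<sigma>) = 2 * string_code \<sigma> + (if b then 2 else 1)"

lemma bij_string_code: "bij string_code"
proof (rule bijI)
  show "inj string_code"
  proof (rule injI)
    show "x = y" if "string_code x = string_code y" for x y
      using that
    proof (induction x arbitrary: y)
      case Nil
      then show ?case by (cases y) (auto split: if_splits)
    next
      case (Cons b x)
      from Cons.prems obtain c z where y: "y = c # z"
        by (cases y) (auto split: if_splits)
      have "b = c" "string_code x = string_code z"
        using Cons.prems unfolding y by (cases b; cases c; simp; presburger)+
      with Cons.IH y show ?case by simp
    qed
  qed
  have "\<exists>\<sigma>. n = string_code \<sigma>" for n
  proof (induction n rule: less_induct)
    case (less n)
    show ?case
    proof (cases "n = 0")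
      case True
      then have "n = string_code []" by simp
      then show ?thesis ..
    next
      case False
      then have "(n - 1) div 2 < n" by simp
      from less.IH[OF this] obtain \<sigma> where "(n - 1) div 2 = string_code \<sigma>" ..
      moreover have "n = 2 * ((n - 1) div 2) + (if even n then 2 else 1)"
        using False by (auto elim!: evenE oddE)
      ultimately have "n = string_code (even n # \<sigma>)" by simp
      then show ?thesis ..
    qed
  qed
  then show "surj string_code" by (auto simp: surj_def)
qed

definition ce_strings :: "bool list set \<Rightarrow> bool" where
  "ce_strings S \<longleftrightarrow> comp_enum (string_code ` S)"

definition uniformly_ce_strings :: "(nat \<Rightarrow> bool list set) \<Rightarrow> bool" where
  "uniformly_ce_strings S \<longleftrightarrow> comp_enum {prod_encode (m, string_code \<sigma>) | m \<sigma>. \<sigma> \<in> S m}"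

type_synonym cantor = "nat \<Rightarrow> bool"

definition initial_segment :: "bool list \<Rightarrow> cantor \<Rightarrow> bool" where
  "initial_segment \<sigma> Y \<longleftrightarrow> (\<forall>i<length \<sigma>. \<sigma> ! i = Y i)"

definition open_class :: "bool list set \<Rightarrow> cantor set" where
  "open_class S = {Y. \<exists>\<sigma>\<in>S. initial_segment \<sigma> Y}"

definition sigma01_class :: "cantor set \<Rightarrow> bool" where
  "sigma01_class U \<longleftrightarrow> (\<exists>S. ce_strings S \<and> U = open_class S)"

definition pi01_class :: "cantor set \<Rightarrow> bool" where
  "pi01_class P \<longleftrightarrow> sigma01_class (- P)"

definition cantor_measure :: "cantor measure" where
  "cantor_measure = (\<Pi>\<^sub>M i\<in>UNIV. measure_pmf (pmf_of_set (UNIV :: bool set)))"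

definition martin_loef_test :: "(nat \<Rightarrow> cantor set) \<Rightarrow> bool" where
  "martin_loef_test U \<longleftrightarrow>
     (\<exists>S. uniformly_ce_strings S \<and> (\<forall>m. U m = open_class (S m))) \<and>
     (\<forall>m. measure cantor_measure (U m) \<le> (1 / 2) ^ m)"

definition martin_loef_random :: "cantor \<Rightarrow> bool" where
  "martin_loef_random Z \<longleftrightarrow> (\<forall>U. martin_loef_test U \<longrightarrow> Z \<notin> (\<Inter>m. U m))"

definition cantor_shift :: "cantor \<Rightarrow> cantor" where
  "cantor_shift Z = (\<lambda>i. Z (Suc i))"

definition k_recurrent :: "nat \<Rightarrow> cantor set \<Rightarrow> cantor \<Rightarrow> bool" where
  "k_recurrent k P Z \<longleftrightarrow> (\<exists>n\<ge>1. Z \<in> (\<Inter>i\<in>{1..k}. (cantor_shift ^^ (n * i)) -` P))"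

definition multiply_recurrent :: "cantor set \<Rightarrow> cantor \<Rightarrow> bool" where
  "multiply_recurrent P Z \<longleftrightarrow> (\<forall>k\<ge>1. k_recurrent k P Z)"

lemma multiply_recurrent_iff:
  "multiply_recurrent P Z \<longleftrightarrow>
    (\<forall>k\<ge>1. \<exists>n\<ge>1. \<forall>i\<in>{1..k}. (cantor_shift ^^ (n * i)) Z \<in> P)"
  by (simp add: multiply_recurrent_def k_recurrent_def)

end

theory Submission
  imports Defs
begin

text \<open>
  Let \<open>U\<close> be the complement of \<open>P\<close> and \<open>V\<^sub>n\<close> the union of \<open>T\<^bsup>-ni\<^esup>(U)\<close> for \<open>1 \<le> i \<le> k\<close>.
  Approximating \<open>U\<close> from inside by a clopen set and using that blocks of bits at disjoint positions
  are independent, one finds \<open>N\<close> and \<open>r < 1\<close> with \<open>\<lambda>(V\<^sub>n) \<le> r\<close> for all \<open>n \<ge> N\<close>. If \<open>Z\<close> is not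
  \<open>k\<close>-recurrent, it lies in every \<open>V\<^sub>n\<close>. Define stopping times: wait until finitely many bits \<open>t\<close>
  of the sequence witness membership in the current \<open>V\<^sub>n\<close>, then continue with \<open>V\<^bsub>N+t\<^esub>\<close>, which
  depends only on the bits from position \<open>t\<close> on. By independence, the class of sequences with at least
  \<open>m\<close> successive hits has measure at most \<open>r\<^sup>m\<close>, whereas \<open>Z\<close> has infinitely many hits. As it is
  decidable how many hits a finite string contains, a subsequence of these classes is a
  Martin-Loef test that \<open>Z\<close> fails.
\<close>

section \<open>Closure properties of recursive functions\<close>

text \<open>\<open>recursive\<close> fixes a function on all lists, including those of the wrong
  length, where the values are accidental. Closing it under agreement on lists of length
  \<open>n\<close> lets the rules below speak of ordinary lambda terms.\<close>

definition recfun :: "nat \<Rightarrow> (nat list \<Rightarrow> nat) \<Rightarrow> bool" where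
  "recfun n f \<longleftrightarrow> (\<exists>g. recursive n g \<and> (\<forall>xs. length xs = n \<longrightarrow> f xs = g xs))"

text \<open>Truth is coded by 0, so that minimization, which searches for a zero, finds the least
  witness of a predicate.\<close>

definition recpred :: "nat \<Rightarrow> (nat list \<Rightarrow> bool) \<Rightarrow> bool" where
  "recpred n P \<longleftrightarrow> recfun n (\<lambda>xs. if P xs then 0 else 1)"

lemma recfun_cong:
  assumes "recfun n f" "\<And>xs. length xs = n \<Longrightarrow> g xs = f xs"
  shows "recfun n g"
  using assms unfolding recfun_def by auto

lemma recpred_cong:
  assumes "recpred n P" "\<And>xs. length xs = n \<Longrightarrow> Q xs = P xs"
  shows "recpred n Q"
  using assms(1) unfolding recpred_def by (rule recfun_cong) (simp add: assms(2))

lemma recfun_nth: "i < n \<Longrightarrow> recfun n (\<lambda>xs. xs ! i)"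
  unfolding recfun_def using recursive.proj by blast

lemma recfun_comp1:
  assumes "recfun 1 (\<lambda>xs. h (xs ! 0))" "recfun n f"
  shows "recfun n (\<lambda>xs. h (f xs))"
proof -
  obtain h' f' where h: "recursive 1 h'" "\<And>xs. length xs = 1 \<Longrightarrow> h (xs ! 0) = h' xs"
    and f: "recursive n f'" "\<And>xs. length xs = n \<Longrightarrow> f xs = f' xs"
    using assms unfolding recfun_def by blast
  have "recursive n (\<lambda>xs. h' (map (\<lambda>f. f xs) [f']))"
    using h(1) f(1) by (intro recursive.comp) auto
  moreover have "h (f xs) = h' (map (\<lambda>f. f xs) [f'])" if "length xs = n" for xs
    using h(2)[of "[f' xs]"] f(2)[OF that] by simp
  ultimately show ?thesis unfolding recfun_def by blast
qed

lemma recfun_comp2: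
  assumes "recfun 2 (\<lambda>xs. h (xs ! 0) (xs ! 1))" "recfun n f" "recfun n g"
  shows "recfun n (\<lambda>xs. h (f xs) (g xs))"
proof -
  obtain h' f' g' where h: "recursive 2 h'" "\<And>xs. length xs = 2 \<Longrightarrow> h (xs ! 0) (xs ! 1) = h' xs"
    and f: "recursive n f'" "\<And>xs. length xs = n \<Longrightarrow> f xs = f' xs"
    and g: "recursive n g'" "\<And>xs. length xs = n \<Longrightarrow> g xs = g' xs"
    using assms unfolding recfun_def by blast
  have "recursive n (\<lambda>xs. h' (map (\<lambda>f. f xs) [f', g']))"
    using h(1) f(1) g(1) by (intro recursive.comp) (auto simp: numeral_2_eq_2)
  moreover have "h (f xs) (g xs) = h' (map (\<lambda>f. f xs) [f', g'])" if "length xs = n" for xs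
    using h(2)[of "[f' xs, g' xs]"] f(2)[OF that] g(2)[OF that] by simp
  ultimately show ?thesis unfolding recfun_def by blast
qed

lemma recfun_comp3:
  assumes "recfun 3 (\<lambda>xs. h (xs ! 0) (xs ! 1) (xs ! 2))" "recfun n f" "recfun n g" "recfun n e"
  shows "recfun n (\<lambda>xs. h (f xs) (g xs) (e xs))"
proof -
  obtain h' f' g' e' where
    h: "recursive 3 h'" "\<And>xs. length xs = 3 \<Longrightarrow> h (xs ! 0) (xs ! 1) (xs ! 2) = h' xs"
    and f: "recursive n f'" "\<And>xs. length xs = n \<Longrightarrow> f xs = f' xs"
    and g: "recursive n g'" "\<And>xs. length xs = n \<Longrightarrow> g xs = g' xs"
    and e: "recursive n e'" "\<And>xs. length xs = n \<Longrightarrow> e xs = e' xs"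
    using assms unfolding recfun_def by blast
  have "recursive n (\<lambda>xs. h' (map (\<lambda>f. f xs) [f', g', e']))"
    using h(1) f(1) g(1) e(1) by (intro recursive.comp) (auto simp: numeral_3_eq_3)
  moreover have "h (f xs) (g xs) (e xs) = h' (map (\<lambda>f. f xs) [f', g', e'])" if "length xs = n" for xs
    using h(2)[of "[f' xs, g' xs, e' xs]"] f(2)[OF that] g(2)[OF that] e(2)[OF that] by simp
  ultimately show ?thesis unfolding recfun_def by blast
qed

lemma recpred_comp3:
  assumes "recpred 3 (\<lambda>xs. P (xs ! 0) (xs ! 1) (xs ! 2))" "recfun n f" "recfun n g" "recfun n e"
  shows "recpred n (\<lambda>xs. P (f xs) (g xs) (e xs))"
  using recfun_comp3[of "\<lambda>x y z. if P x y z then 0 else 1"] assms unfolding recpred_def by simp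

lemma recfun_Suc: "recfun n f \<Longrightarrow> recfun n (\<lambda>xs. Suc (f xs))"
  by (rule recfun_comp1) (use recursive.succ in \<open>auto simp: recfun_def\<close>)

lemma recfun_const: "recfun n (\<lambda>xs. c)"
proof (induction c)
  case 0
  show ?case unfolding recfun_def using recursive.zero by blast
qed (rule recfun_Suc)

text \<open>\<open>prec\<close> recurses on the head of its argument list. Composing with
  \<open>a\<close> followed by all projections turns any recursive \<open>a\<close> into the
  recursion argument and keeps \<open>xs\<close> as parameters. The premise uses \<open>hd\<close>
  and \<open>tl\<close> so that unification can read off \<open>h\<close> from the goal.\<close>

lemma recfun_rec_nat:
  assumes a: "recfun n a" and g: "recfun n g"
    and h: "recfun (Suc (Suc n)) (\<lambda>zs. h (hd zs) (hd (tl zs)) (tl (tl zs)))"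
  shows "recfun n (\<lambda>xs. rec_nat (g xs) (\<lambda>y r. h y r xs) (a xs))"
proof -
  obtain a' g' h' where a': "recursive n a'" "\<And>xs. length xs = n \<Longrightarrow> a xs = a' xs"
    and g': "recursive n g'" "\<And>xs. length xs = n \<Longrightarrow> g xs = g' xs"
    and h': "recursive (Suc (Suc n)) h'"
      "\<And>zs. length zs = Suc (Suc n) \<Longrightarrow> h (hd zs) (hd (tl zs)) (tl (tl zs)) = h' zs"
    using assms unfolding recfun_def by blast
  define R where "R = (\<lambda>xs. rec_nat (g' (tl xs)) (\<lambda>y r. h' (y # r # tl xs)) (hd xs))"
  define fs where "fs = a' # map (\<lambda>i xs. xs ! i) [0..<n]"
  have "recursive (length fs) R"
    unfolding R_def fs_def using recursive.prec[OF g'(1) h'(1)] by simp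
  moreover have "\<forall>f\<in>set fs. recursive n f"
    using a'(1) recursive.proj by (auto simp: fs_def)
  ultimately have "recursive n (\<lambda>xs. R (map (\<lambda>f. f xs) fs))"
    by (rule recursive.comp)
  moreover have "rec_nat (g xs) (\<lambda>y r. h y r xs) (a xs) = R (map (\<lambda>f. f xs) fs)"
    if "length xs = n" for xs
  proof -
    have "map (\<lambda>f. f xs) fs = a xs # xs"
      using that a'(2) by (auto simp: fs_def intro: nth_equalityI)
    moreover have "h y r xs = h' (y # r # xs)" for y r
      using h'(2)[of "y # r # xs"] that by simp
    ultimately show ?thesis using g'(2)[OF that] by (simp add: R_def)
  qed
  ultimately show ?thesis unfolding recfun_def by blast
qed

lemma recfun_Least:
  assumes "recpred (Suc n) (\<lambda>zs. P (hd zs) (tl zs))" "\<And>xs. length xs = n \<Longrightarrow> \<exists>y. P y xs"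
  shows "recfun n (\<lambda>xs. LEAST y. P y xs)"
proof -
  obtain f where f: "recursive (Suc n) f"
    "\<And>zs. length zs = Suc n \<Longrightarrow> (if P (hd zs) (tl zs) then 0 else 1) = f zs"
    using assms unfolding recfun_def recpred_def by blast
  have eq: "f (y # xs) = 0 \<longleftrightarrow> P y xs" if "length xs = n" for y xs
    using f(2)[of "y # xs"] that by (auto split: if_splits)
  have "recursive n (\<lambda>xs. LEAST y. f (y # xs) = 0)"
    using assms(2) by (intro recursive.mini f) (simp add: eq)
  moreover have "(LEAST y. P y xs) = (LEAST y. f (y # xs) = 0)" if "length xs = n" for xs
    by (simp add: eq that)
  ultimately show ?thesis unfolding recfun_def by blast
qed

text \<open>These are the forms in which variables appear in the premises of
  \<open>recfun_rec_nat\<close> and \<open>recfun_Least\<close>.\<close>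

lemma recfun_hd_tl:
  "0 < n \<Longrightarrow> recfun n (\<lambda>zs. hd zs)"
  "1 < n \<Longrightarrow> recfun n (\<lambda>zs. hd (tl zs))"
  "Suc i < n \<Longrightarrow> recfun n (\<lambda>zs. tl zs ! i)"
  "Suc (Suc i) < n \<Longrightarrow> recfun n (\<lambda>zs. tl (tl zs) ! i)"
proof -
  show "recfun n (\<lambda>zs. hd zs)" if "0 < n"
    using recfun_nth[OF that] by (rule recfun_cong) (use that in \<open>auto simp: hd_conv_nth\<close>)
  show "recfun n (\<lambda>zs. hd (tl zs))" if "1 < n"
    using recfun_nth[OF that]
    by (rule recfun_cong) (use that in \<open>auto simp: hd_conv_nth nth_tl simp flip: length_0_conv\<close>)
  show "recfun n (\<lambda>zs. tl zs ! i)" if "Suc i < n"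
    using recfun_nth[OF that] by (rule recfun_cong) (use that in \<open>simp add: nth_tl\<close>)
  show "recfun n (\<lambda>zs. tl (tl zs) ! i)" if "Suc (Suc i) < n"
    using recfun_nth[OF that] by (rule recfun_cong) (use that in \<open>simp add: nth_tl\<close>)
qed

lemmas recfun_vars = recfun_nth recfun_hd_tl recfun_const recfun_Suc

section \<open>Arithmetic with truncated subtraction\<close>

lemma recfun_add:
  assumes "recfun n f" "recfun n g" shows "recfun n (\<lambda>xs. f xs + g xs)"
proof (rule recfun_comp2[OF _ assms])
  have "recfun 2 (\<lambda>xs. rec_nat (xs ! 0) (\<lambda>y r. Suc r) (xs ! 1))"
    by (rule recfun_rec_nat) (auto intro!: recfun_vars)
  moreover have "rec_nat x (\<lambda>y r. Suc r) z = x + z" for x z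
    by (induction z) auto
  ultimately show "recfun 2 (\<lambda>xs. xs ! 0 + xs ! 1)" by simp
qed

lemma recfun_mult:
  assumes "recfun n f" "recfun n g" shows "recfun n (\<lambda>xs. f xs * g xs)"
proof (rule recfun_comp2[OF _ assms])
  have "recfun 2 (\<lambda>xs. rec_nat 0 (\<lambda>y r. xs ! 0 + r) (xs ! 1))"
    by (rule recfun_rec_nat) (auto intro!: recfun_vars recfun_add)
  moreover have "rec_nat 0 (\<lambda>y r. x + r) z = x * z" for x z :: nat
    by (induction z) auto
  ultimately show "recfun 2 (\<lambda>xs. xs ! 0 * xs ! 1)" by simp
qed

lemma recfun_diff:
  assumes "recfun n f" "recfun n g" shows "recfun n (\<lambda>xs. f xs - g xs)"
proof (rule recfun_comp2[OF _ assms])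
  have pred: "recfun n (\<lambda>xs. f xs - 1)" if "recfun n f" for n f
  proof (rule recfun_comp1[OF _ that])
    have "recfun 1 (\<lambda>xs. rec_nat 0 (\<lambda>y r. y) (xs ! 0))"
      by (rule recfun_rec_nat) (auto intro!: recfun_vars)
    moreover have "rec_nat 0 (\<lambda>y r. y) z = z - 1" for z :: nat
      by (cases z) auto
    ultimately show "recfun 1 (\<lambda>xs. xs ! 0 - 1)" by simp
  qed
  have "recfun 2 (\<lambda>xs. rec_nat (xs ! 0) (\<lambda>y r. r - 1) (xs ! 1))"
    by (rule recfun_rec_nat) (auto intro!: recfun_vars pred[unfolded One_nat_def])
  moreover have "rec_nat x (\<lambda>y r. r - 1) z = x - z" for x z :: nat
    by (induction z) auto
  ultimately show "recfun 2 (\<lambda>xs. xs ! 0 - xs ! 1)" by simp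
qed

lemmas recfun_arith = recfun_vars recfun_add recfun_mult recfun_diff

section \<open>Decidable predicates and bounded quantifiers\<close>

lemma recpred_le:
  assumes "recfun n f" "recfun n g" shows "recpred n (\<lambda>xs. f xs \<le> g xs)"
proof -
  \<comment> \<open>By truncation, \<open>Suc (g xs) - f xs\<close> is positive exactly if
    \<open>f xs \<le> g xs\<close>, and subtracting it from 1 gives the required 0 or 1.\<close>
  have "recfun n (\<lambda>xs. 1 - (Suc (g xs) - f xs))"
    using assms by (intro recfun_arith)
  then show ?thesis unfolding recpred_def by (rule recfun_cong) auto
qed

lemma recpred_not: "recpred n P \<Longrightarrow> recpred n (\<lambda>xs. \<not> P xs)"
proof -
  assume "recpred n P"
  then have "recfun n (\<lambda>xs. 1 - (if P xs then 0 else 1))"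
    unfolding recpred_def by (intro recfun_arith)
  then show ?thesis unfolding recpred_def by (rule recfun_cong) auto
qed

lemma recpred_conj:
  assumes "recpred n P" "recpred n Q" shows "recpred n (\<lambda>xs. P xs \<and> Q xs)"
proof -
  have "recfun n (\<lambda>xs. 1 - (1 - (if P xs then 0 else 1)) * (1 - (if Q xs then 0 else 1)))"
    using assms unfolding recpred_def by (intro recfun_arith)
  then show ?thesis unfolding recpred_def by (rule recfun_cong) auto
qed

lemma recpred_less:
  "recfun n f \<Longrightarrow> recfun n g \<Longrightarrow> recpred n (\<lambda>xs. f xs < g xs)"
  using recpred_le[of n "\<lambda>xs. Suc (f xs)" g] recfun_Suc[of n f] by (simp add: Suc_le_eq)

lemma recpred_eq:
  "recfun n f \<Longrightarrow> recfun n g \<Longrightarrow> recpred n (\<lambda>xs. f xs = g xs)"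
  using recpred_conj[OF recpred_le[of n f g] recpred_le[of n g f]] by (simp add: order_eq_iff)

lemma recpred_iff:
  assumes "recpred n P" "recpred n Q" shows "recpred n (\<lambda>xs. P xs = Q xs)"
proof -
  have "recpred n (\<lambda>xs. (if P xs then 0::nat else 1) = (if Q xs then 0 else 1))"
    using assms unfolding recpred_def[of n P] recpred_def[of n Q] by (rule recpred_eq)
  then show ?thesis by (rule recpred_cong) auto
qed

lemma recfun_if:
  assumes "recpred n P" "recfun n f" "recfun n g"
  shows "recfun n (\<lambda>xs. if P xs then f xs else g xs)"
proof -
  have "recfun n (\<lambda>xs. (1 - (if P xs then 0 else 1)) * f xs + (if P xs then 0 else 1) * g xs)"
    using assms unfolding recpred_def by (intro recfun_arith)
  then show ?thesis by (rule recfun_cong) auto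
qed

text \<open>Search for the least \<open>y\<close> that satisfies \<open>P\<close> or reaches the
  bound. The bound makes the search total, and a witness exists iff the result lies below the
  bound.\<close>

lemma recpred_ex_less:
  assumes "recfun n b" "recpred (Suc n) (\<lambda>zs. P (hd zs) (tl zs))"
  shows "recpred n (\<lambda>xs. \<exists>y<b xs. P y xs)"
proof -
  \<comment> \<open>This is the disjunction of \<open>P\<close> and \<open>b \<le> y\<close>,
    written with the connectives for which closure is available.\<close>
  have "recpred (Suc n) (\<lambda>zs. \<not> (\<not> P (hd zs) (tl zs) \<and> \<not> b (tl zs) \<le> hd zs))"
  proof (intro recpred_not recpred_conj assms recpred_le recfun_hd_tl)
    obtain b' where b': "recursive n b'" "\<And>xs. length xs = n \<Longrightarrow> b xs = b' xs"
      using assms unfolding recfun_def by blast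
    \<comment> \<open>Composition with the projections moved by one place makes \<open>b'\<close>
      ignore the search variable.\<close>
    have "recursive (Suc n) (\<lambda>xs. b' (map (\<lambda>f. f xs) (map (\<lambda>i xs. xs ! Suc i) [0..<n])))"
      using b'(1) by (intro recursive.comp) (auto intro: recursive.proj)
    moreover have "b (tl xs) = b' (map (\<lambda>f. f xs) (map (\<lambda>i xs. xs ! Suc i) [0..<n]))"
      if "length xs = Suc n" for xs
    proof -
      have "map (\<lambda>f. f xs) (map (\<lambda>i xs. xs ! Suc i) [0..<n]) = tl xs"
        using that by (auto intro!: nth_equalityI simp: nth_tl)
      then show ?thesis using b'(2)[of "tl xs"] that by simp
    qed
    ultimately show "recfun (Suc n) (\<lambda>xs. b (tl xs))"
      unfolding recfun_def by blast
  qed simp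
  then have "recfun n (\<lambda>xs. LEAST y. \<not> (\<not> P y xs \<and> \<not> b xs \<le> y))"
    by (rule recfun_Least) auto
  then have "recpred n (\<lambda>xs. (LEAST y. \<not> (\<not> P y xs \<and> \<not> b xs \<le> y)) < b xs)"
    by (rule recpred_less) (rule assms)
  moreover have "(LEAST y. \<not> (\<not> P y xs \<and> \<not> b xs \<le> y)) < b xs \<longleftrightarrow> (\<exists>y<b xs. P y xs)"
    (is "?l < _ \<longleftrightarrow> _") for xs
  proof
    assume "?l < b xs"
    moreover have "\<not> (\<not> P ?l xs \<and> \<not> b xs \<le> ?l)"
      by (rule LeastI[of _ "b xs"]) simp
    ultimately show "\<exists>y<b xs. P y xs" by auto
  next
    assume "\<exists>y<b xs. P y xs"
    then obtain y where "y < b xs" "P y xs" by blast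
    moreover from this have "?l \<le> y" by (intro Least_le) simp
    ultimately show "?l < b xs" by simp
  qed
  ultimately show ?thesis by simp
qed

lemma recpred_all_less:
  assumes "recfun n b" "recpred (Suc n) (\<lambda>zs. P (hd zs) (tl zs))"
  shows "recpred n (\<lambda>xs. \<forall>y<b xs. P y xs)"
  using recpred_not[OF recpred_ex_less[OF assms(1) recpred_not[OF assms(2)]]] by simp

section \<open>Halving and the inverse of the pairing function\<close>

lemma recfun_div2:
  assumes "recfun n f" shows "recfun n (\<lambda>xs. f xs div 2)"
proof (rule recfun_comp1[OF _ assms])
  have "recfun 1 (\<lambda>xs. LEAST y. xs ! 0 < 2 * Suc y)"
  proof (rule recfun_Least)
    show "\<exists>y. xs ! 0 < 2 * Suc y" for xs
      by (rule exI[of _ "xs ! 0"]) simp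
  qed (intro recpred_less recfun_arith, simp_all)
  moreover have "(LEAST y. x < 2 * Suc y) = x div 2" for x :: nat
    by (rule Least_equality) auto
  ultimately show "recfun 1 (\<lambda>xs. xs ! 0 div 2)" by simp
qed

lemma recpred_even:
  assumes "recfun n f" shows "recpred n (\<lambda>xs. even (f xs))"
proof -
  have "recpred n (\<lambda>xs. f xs = 2 * (f xs div 2))"
    using assms by (intro recpred_eq recfun_arith recfun_div2)
  then show ?thesis by (rule recpred_cong) presburger
qed

text \<open>The code of \<open>(x, y)\<close> is \<open>triangle (x + y) + x\<close>, which lies
  between \<open>triangle (x + y)\<close> and \<open>triangle (Suc (x + y))\<close>. Minimization
  therefore finds the diagonal \<open>x + y\<close>, and subtraction gives both coordinates.\<close>

lemma recfun_prod_decode: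
  assumes "recfun n f"
  shows "recfun n (\<lambda>xs. fst (prod_decode (f xs)))" "recfun n (\<lambda>xs. snd (prod_decode (f xs)))"
proof -
  define s where "s = (\<lambda>x. LEAST y. x < triangle (Suc y))"
  have "recfun 1 (\<lambda>xs. LEAST y. xs ! 0 < triangle (Suc y))"
    unfolding triangle_def
  proof (rule recfun_Least)
    show "\<exists>y. xs ! 0 < Suc y * Suc (Suc y) div 2" for xs
      by (rule exI[of _ "xs ! 0"]) simp
  qed (intro recpred_less recfun_arith recfun_div2, simp_all)
  then have s: "recfun n (\<lambda>xs. s (f xs))"
    unfolding s_def by (rule recfun_comp1) (rule assms)
  have mono: "triangle x \<le> triangle y" if "x \<le> y" for x y
    using that by (induction rule: dec_induct) auto
  have s_eq: "s (prod_encode (x, y)) = x + y" for x y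
    unfolding s_def prod_encode_def
  proof (rule Least_equality)
    fix z assume "(case (x, y) of (m, n) \<Rightarrow> triangle (m + n) + m) < triangle (Suc z)"
    then show "x + y \<le> z"
      using mono[of "Suc z" "x + y"] by (cases "x + y \<le> z") auto
  qed auto
  have "s x = fst (prod_decode x) + snd (prod_decode x)"
    "x = triangle (fst (prod_decode x) + snd (prod_decode x)) + fst (prod_decode x)" for x
    using s_eq[of "fst (prod_decode x)" "snd (prod_decode x)"]
      prod_decode_inverse[of x, unfolded prod_encode_def] by (simp_all add: case_prod_beta)
  then have fst_eq: "fst (prod_decode x) = x - triangle (s x)"
    and snd_eq: "snd (prod_decode x) = s x - fst (prod_decode x)" for x
    by (metis add_diff_cancel_left')+
  show fst: "recfun n (\<lambda>xs. fst (prod_decode (f xs)))"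
    unfolding fst_eq triangle_def using s assms by (intro recfun_arith recfun_div2)
  show "recfun n (\<lambda>xs. snd (prod_decode (f xs)))"
    unfolding snd_eq using s fst by (intro recfun_arith)
qed

text \<open>A nonempty decidable set is the range of the function that fixes its members and sends
  all other numbers to one chosen member.\<close>

lemma comp_enum_recpred:
  assumes "recpred 1 (\<lambda>xs. P (xs ! 0))"
  shows "comp_enum {x. P x}"
proof (cases "{x. P x} = {}")
  case False
  then obtain a where a: "P a" by blast
  define f where "f = (\<lambda>x. if P x then x else a)"
  have "recfun 1 (\<lambda>xs. f (xs ! 0))"
    unfolding f_def using assms by (intro recfun_if recfun_vars) auto
  then obtain g where g: "recursive 1 g" "\<And>xs. length xs = 1 \<Longrightarrow> f (xs ! 0) = g xs"
    unfolding recfun_def by blast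
  then have "computable f"
    unfolding computable_def using g(2)[of "[x]" for x] by (intro exI[of _ g]) simp
  moreover have "{x. P x} = range f"
    using a by (auto simp: f_def)
  ultimately show ?thesis unfolding comp_enum_def by blast
qed (simp add: comp_enum_def)

lemma recfun_computable:
  assumes "computable f" "recfun n g"
  shows "recfun n (\<lambda>xs. f (g xs))"
proof (rule recfun_comp1[OF _ assms(2)])
  obtain h where h: "recursive 1 h" "\<And>x. f x = h [x]"
    using assms(1) unfolding computable_def by blast
  have "f (xs ! 0) = h xs" if "length xs = 1" for xs
    using that by (cases xs) (auto simp: h(2))
  then show "recfun 1 (\<lambda>xs. f (xs ! 0))" unfolding recfun_def using h(1) by blast
qed

section \<open>Operations on string codes\<close>

text \<open>In bijective base 2, \<open>(r - 1) div 2\<close> removes the least significant digit,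
  that is, the first bit. Truncation keeps 0, the code of the empty string, fixed.\<close>

definition code_drop :: "nat \<Rightarrow> nat \<Rightarrow> nat" where
  "code_drop i c = rec_nat c (\<lambda>_ r. (r - 1) div 2) i"

definition code_length :: "nat \<Rightarrow> nat" where
  "code_length c = (LEAST y. code_drop y c = 0)"

text \<open>Digit 2 stands for \<open>True\<close>, whence the parity. Partially applied,
  \<open>code_bit c\<close> is an infinite sequence: the coded string followed by
  \<open>True\<close> forever. The padding is harmless where only bits below the length are
  read.\<close>

definition code_bit :: "nat \<Rightarrow> nat \<Rightarrow> bool" where
  "code_bit c i \<longleftrightarrow> even (code_drop i c)"

lemma code_drop_string_code: "code_drop i (string_code \<sigma>) = string_code (drop i \<sigma>)"
proof (induction i)
  case (Suc i)
  have "(string_code \<tau> - 1) div 2 = string_code (tl \<tau>)" for \<tau>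
    by (cases \<tau>) auto
  with Suc show ?case
    by (simp add: code_drop_def drop_Suc tl_drop)
qed (simp add: code_drop_def)

lemma string_code_eq_0: "string_code \<sigma> = 0 \<longleftrightarrow> \<sigma> = []"
  by (cases \<sigma>) auto

lemma code_length_string_code: "code_length (string_code \<sigma>) = length \<sigma>"
  unfolding code_length_def code_drop_string_code string_code_eq_0
  by (rule Least_equality) auto

lemma code_bit_string_code: "i < length \<sigma> \<Longrightarrow> code_bit (string_code \<sigma>) i \<longleftrightarrow> \<sigma> ! i"
  unfolding code_bit_def code_drop_string_code by (simp flip: Cons_nth_drop_Suc)

lemma recfun_code_drop:
  assumes "recfun n f" "recfun n g"
  shows "recfun n (\<lambda>xs. code_drop (f xs) (g xs))"
  by (rule recfun_comp2[OF _ assms], unfold code_drop_def, rule recfun_rec_nat)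
    (intro recfun_arith recfun_div2, simp_all)+

lemma recfun_code_length:
  assumes "recfun n f" shows "recfun n (\<lambda>xs. code_length (f xs))"
proof (rule recfun_comp1[OF _ assms], unfold code_length_def, rule recfun_Least)
  show "\<exists>y. code_drop y (xs ! 0) = 0" for xs
  proof -
    obtain \<sigma> where "xs ! 0 = string_code \<sigma>"
      using bij_string_code by (metis bij_pointE)
    then show ?thesis
      by (intro exI[of _ "length \<sigma>"]) (simp add: code_drop_string_code)
  qed
qed (intro recpred_eq recfun_code_drop recfun_arith, simp_all)

lemma recpred_code_bit:
  "recfun n f \<Longrightarrow> recfun n g \<Longrightarrow> recpred n (\<lambda>xs. code_bit (f xs) (g xs))"
  unfolding code_bit_def by (intro recpred_even recfun_code_drop)

section \<open>Decidability of the hit count\<close>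

text \<open>
  The first \<open>l\<close> bits of \<open>Y\<close> and the first \<open>l\<close> strings enumerated show that \<open>T\<^bsup>ni\<^esup>(Y)\<close> lies in the
  open class generated by \<open>p\<close> for some \<open>1 \<le> i \<le> k\<close> (the bound variable \<open>i\<close> is shifted by one).
\<close>

definition hits :: "(nat \<Rightarrow> bool list) \<Rightarrow> nat \<Rightarrow> nat \<Rightarrow> nat \<Rightarrow> cantor \<Rightarrow> bool" where
  "hits p k n l Y \<longleftrightarrow> (\<exists>i<k. \<exists>j<l. length (p j) + n * Suc i \<le> l \<and>
     (\<forall>x<length (p j). p j ! x = Y (n * Suc i + x)))"

text \<open>The stopping times. After a hit at time \<open>t\<close> the search is for index
  \<open>N + t\<close>; as all offsets \<open>(N + t) * Suc i\<close> are at least \<open>t\<close>,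
  it reads no bit that was used before. The start counts as time 0.\<close>

primrec last_hit :: "(nat \<Rightarrow> bool list) \<Rightarrow> nat \<Rightarrow> nat \<Rightarrow> cantor \<Rightarrow> nat \<Rightarrow> nat" where
  "last_hit p k N Y 0 = 0"
| "last_hit p k N Y (Suc l) =
     (if hits p k (N + last_hit p k N Y l) (Suc l) Y then Suc l else last_hit p k N Y l)"

text \<open>\<open>last_hit\<close> at \<open>Suc l\<close> is either \<open>Suc l\<close> or a
  value at most \<open>l\<close>, so the equation tested says that a hit occurs at this very
  stage.\<close>

primrec hit_count :: "(nat \<Rightarrow> bool list) \<Rightarrow> nat \<Rightarrow> nat \<Rightarrow> cantor \<Rightarrow> nat \<Rightarrow> nat" where
  "hit_count p k N Y 0 = 0"
| "hit_count p k N Y (Suc l) =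
     hit_count p k N Y l + (if last_hit p k N Y (Suc l) = Suc l then 1 else 0)"

context
  fixes p :: "nat \<Rightarrow> bool list"
  assumes comp_p: "computable (\<lambda>j. string_code (p j))"
begin

text \<open>All quantifiers in \<open>hits\<close> are bounded. The sequence is given by a number
  through \<open>code_bit\<close>, and the strings \<open>p j\<close> are accessed through their
  computable codes only.\<close>

lemma recpred_hits:
  assumes "recfun n f" "recfun n g" "recfun n e"
  shows "recpred n (\<lambda>xs. hits p k (f xs) (g xs) (code_bit (e xs)))"
proof (rule recpred_comp3[OF _ assms])
  define match where "match = (\<lambda>q s u. \<forall>x<code_length q. code_bit q x = code_bit s (u + x))"
  have match: "recpred n (\<lambda>xs. match (f xs) (g xs) (e xs))"
    if "recfun n f" "recfun n g" "recfun n e" for n f g e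
    by (rule recpred_comp3[OF _ that], unfold match_def)
      (intro recpred_all_less recpred_iff recpred_code_bit recfun_code_length recfun_arith, simp_all)
  define found where "found = (\<lambda>i j m l s. code_length (string_code (p j)) + m * Suc i \<le> l \<and>
    match (string_code (p j)) s (m * Suc i))"
  have "hits p k m l (code_bit s) \<longleftrightarrow> (\<exists>i<k. \<exists>j<l. found i j m l s)" for m l s
    unfolding hits_def found_def match_def by (auto simp: code_length_string_code code_bit_string_code)
  then show "recpred 3 (\<lambda>xs. hits p k (xs ! 0) (xs ! 1) (code_bit (xs ! 2)))"
    unfolding found_def
    by simp (intro recpred_ex_less recpred_conj recpred_le match recfun_code_length
        recfun_computable[OF comp_p] recfun_arith, simp_all)
qed

lemma recfun_last_hit:
  assumes "recfun n f" "recfun n g"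
  shows "recfun n (\<lambda>xs. last_hit p k N (code_bit (f xs)) (g xs))"
proof (rule recfun_comp2[OF _ assms])
  have "last_hit p k N Y l = rec_nat 0 (\<lambda>l t. if hits p k (N + t) (Suc l) Y then Suc l else t) l"
    for Y l by (induction l) auto
  then show "recfun 2 (\<lambda>xs. last_hit p k N (code_bit (xs ! 0)) (xs ! 1))"
    by simp (rule recfun_rec_nat; intro recfun_if recpred_hits recfun_arith; simp)
qed

lemma recfun_hit_count:
  assumes "recfun n f" "recfun n g"
  shows "recfun n (\<lambda>xs. hit_count p k N (code_bit (f xs)) (g xs))"
proof (rule recfun_comp2[OF _ assms])
  have "hit_count p k N Y l =
    rec_nat 0 (\<lambda>l c. c + (if last_hit p k N Y (Suc l) = Suc l then 1 else 0)) l"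
    for Y l by (induction l) auto
  then show "recfun 2 (\<lambda>xs. hit_count p k N (code_bit (xs ! 0)) (xs ! 1))"
    by (simp only:) (rule recfun_rec_nat; intro recfun_if recpred_eq recfun_last_hit recfun_arith; simp)
qed

text \<open>The set of coded pairs is even decidable. The factor \<open>e\<close> is there to pick a
  subsequence whose measures decrease fast enough for a Martin-Loef test.\<close>

lemma uniformly_ce_hit_count:
  "uniformly_ce_strings
    (\<lambda>m. {\<sigma>. e * m \<le> hit_count p k N (code_bit (string_code \<sigma>)) (length \<sigma>)})"
proof -
  let ?P = "\<lambda>x. e * fst (prod_decode x) \<le>
    hit_count p k N (code_bit (snd (prod_decode x))) (code_length (snd (prod_decode x)))"
  have "recpred 1 (\<lambda>xs. ?P (xs ! 0))"
    by (intro recpred_le recfun_hit_count recfun_code_length recfun_prod_decode recfun_arith) simp_all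
  then have "comp_enum {x. ?P x}"
    by (rule comp_enum_recpred)
  moreover have "{prod_encode (m, string_code \<sigma>) | m \<sigma>.
      \<sigma> \<in> {\<sigma>. e * m \<le> hit_count p k N (code_bit (string_code \<sigma>)) (length \<sigma>)}} = {x. ?P x}"
    (is "?A = ?B")
  proof
    show "?A \<subseteq> ?B" by (auto simp: code_length_string_code)
    show "?B \<subseteq> ?A"
    proof
      fix x assume x: "x \<in> ?B"
      obtain m c where mc: "prod_decode x = (m, c)" by fastforce
      obtain \<sigma> where "c = string_code \<sigma>"
        using bij_string_code by (metis bij_pointE)
      moreover have "x = prod_encode (m, c)"
        using mc by (metis prod_decode_inverse)
      ultimately show "x \<in> ?A"
        using x by (auto simp: code_length_string_code)
    qed
  qed
  ultimately show ?thesis unfolding uniformly_ce_strings_def by simp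
qed

end

section \<open>Independence in Cantor space\<close>

interpretation bits: sequence_space "measure_pmf (pmf_of_set (UNIV :: bool set))"
  by unfold_locales

interpretation cantor: prob_space cantor_measure
  unfolding cantor_measure_def by (rule bits.P.prob_space_axioms)

lemma space_cantor [simp]: "space cantor_measure = UNIV"
  by (auto simp: cantor_measure_def space_PiM)

lemma UNIV_in_sets_cantor [simp]: "UNIV \<in> sets cantor_measure"
  using sets.top[of cantor_measure] by simp

lemma shift_funpow: "(cantor_shift ^^ n) Y = (\<lambda>i. Y (n + i))"
  by (induction n) (auto simp: cantor_shift_def)

lemma sets_initial_segment: "{Y. initial_segment \<sigma> Y} \<in> sets cantor_measure"
proof -
  have "{Y \<in> space cantor_measure. \<forall>i\<in>{..<length \<sigma>}. \<sigma> ! i = Y i} \<in> sets cantor_measure"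
  proof (rule sets.sets_Collect_finite_All)
    fix i assume "i \<in> {..<length \<sigma>}"
    have "{Y \<in> space bits.S. Y i \<in> {\<sigma> ! i}} \<in> sets bits.S"
      by (intro sets_Collect_single) auto
    then show "{Y \<in> space cantor_measure. \<sigma> ! i = Y i} \<in> sets cantor_measure"
      by (simp add: cantor_measure_def eq_commute)
  qed simp
  then show ?thesis by (simp add: initial_segment_def Ball_def)
qed

lemma sets_open_class: "open_class S \<in> sets cantor_measure"
proof -
  have "open_class S = (\<Union>\<sigma>\<in>S. {Y. initial_segment \<sigma> Y})"
    by (auto simp: open_class_def)
  then show ?thesis by (auto intro: sets.countable_UN'' sets_initial_segment)
qed

section \<open>Clopen sets and independence of disjoint blocks of bits\<close>

definition determined :: "nat \<Rightarrow> cantor set \<Rightarrow> bool" where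
  "determined n A \<longleftrightarrow> (\<forall>Y Y'. (\<forall>i<n. Y i = Y' i) \<longrightarrow> Y \<in> A \<longrightarrow> Y' \<in> A)"

lemma determined_mono:
  assumes "determined m A" "m \<le> n" shows "determined n A"
  unfolding determined_def
proof (intro allI impI)
  fix Y Y' assume "\<forall>i<n. Y i = Y' i" "Y \<in> A"
  moreover from this assms(2) have "\<forall>i<m. Y i = Y' i" by simp
  ultimately show "Y' \<in> A" using assms(1) unfolding determined_def by blast
qed

text \<open>\<open>A\<close> is the union of the cylinders of the prefixes of length
  \<open>n\<close> of its members.\<close>

lemma sets_determined:
  assumes "determined n A" shows "A \<in> sets cantor_measure"
proof -
  have "A = open_class ((\<lambda>Y. map Y [0..<n]) ` A)"
    using assms by (auto simp: open_class_def initial_segment_def determined_def)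
  then show ?thesis using sets_open_class by metis
qed

lemma sets_shift:
  assumes "W \<in> sets cantor_measure" shows "(cantor_shift ^^ n) -` W \<in> sets cantor_measure"
proof -
  have "(\<lambda>Y i. Y (n + i)) \<in> measurable bits.S bits.S"
    by (intro measurable_PiM_single') (auto simp: space_PiM)
  then have "(cantor_shift ^^ n) \<in> measurable cantor_measure cantor_measure"
    by (simp add: shift_funpow[abs_def] cantor_measure_def)
  from measurable_sets[OF this assms] show ?thesis by simp
qed

text \<open>Splicing the first \<open>n\<close> bits of one sequence to another sequence maps the
  product of two copies of the measure to the measure itself. The preimage of the intersection under
  splicing is the rectangle \<open>A \<times> W\<close>.\<close>

lemma measure_determined_Int_shift:
  assumes A: "determined n A" and W: "W \<in> sets cantor_measure"
  shows "measure cantor_measure (A \<inter> (cantor_shift ^^ n) -` W) =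
    measure cantor_measure A * measure cantor_measure W"
proof -
  let ?S = bits.S and ?c = "\<lambda>(\<omega>, \<omega>'). comb_seq n \<omega> \<omega>'"
  have sets: "A \<in> sets ?S" "W \<in> sets ?S" "A \<inter> (cantor_shift ^^ n) -` W \<in> sets ?S"
    using sets_determined[OF A] W sets_shift[OF W] unfolding cantor_measure_def by auto
  have c: "?c (\<omega>, \<omega>') \<in> A \<inter> (cantor_shift ^^ n) -` W \<longleftrightarrow> \<omega> \<in> A \<and> \<omega>' \<in> W" for \<omega> \<omega>'
  proof -
    have "(cantor_shift ^^ n) (comb_seq n \<omega> \<omega>') = \<omega>'"
      by (auto simp: shift_funpow comb_seq_def)
    moreover have "comb_seq n \<omega> \<omega>' \<in> A \<longleftrightarrow> \<omega> \<in> A"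
      using A unfolding determined_def by (metis comb_seq_less)
    ultimately show ?thesis by simp
  qed
  have "measure ?S (A \<inter> (cantor_shift ^^ n) -` W) =
      measure (distr (?S \<Otimes>\<^sub>M ?S) ?S ?c) (A \<inter> (cantor_shift ^^ n) -` W)"
    by (simp only: bits.PiM_comb_seq)
  also have "\<dots> = measure (?S \<Otimes>\<^sub>M ?S) (?c -` (A \<inter> (cantor_shift ^^ n) -` W) \<inter> space (?S \<Otimes>\<^sub>M ?S))"
    by (rule measure_distr[OF measurable_comb_seq sets(3)])
  also have "?c -` (A \<inter> (cantor_shift ^^ n) -` W) \<inter> space (?S \<Otimes>\<^sub>M ?S) = A \<times> W"
    using c by (simp add: space_pair_measure space_PiM set_eq_iff)
  also have "measure (?S \<Otimes>\<^sub>M ?S) (A \<times> W) = measure ?S A * measure ?S W"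
    using sets by (simp add: measure_def bits.P.emeasure_pair_measure_Times enn2real_mult)
  finally show ?thesis by (simp add: cantor_measure_def)
qed

lemma measure_shift:
  assumes "W \<in> sets cantor_measure"
  shows "measure cantor_measure ((cantor_shift ^^ n) -` W) = measure cantor_measure W"
  using measure_determined_Int_shift[of n UNIV W] assms cantor.prob_space
  by (simp add: determined_def)

text \<open>Induction on \<open>k\<close>: the factor with \<open>i = 0\<close> depends on the first
  \<open>n\<close> bits only, and the remaining ones form the \<open>T^-n\<close> preimage of the
  shorter intersection.\<close>

lemma measure_Int_shift_multiples:
  assumes C: "determined N C" and n: "N \<le> n"
  shows "measure cantor_measure (\<Inter>i<k. (cantor_shift ^^ (n * i)) -` C) =
    measure cantor_measure C ^ k"
proof (induction k)
  case 0
  show ?case using cantor.prob_space by simp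
next
  case (Suc k)
  let ?B = "\<lambda>k. \<Inter>i<k. (cantor_shift ^^ (n * i)) -` C"
  have sets: "?B k \<in> sets cantor_measure"
  proof (cases "k = 0")
    case False
    then show ?thesis by (intro sets.finite_INT sets_shift sets_determined[OF C]) auto
  qed simp
  have "?B (Suc k) = C \<inter> (cantor_shift ^^ n) -` ?B k"
    by (auto simp: lessThan_Suc_eq_insert_0 shift_funpow add.assoc)
  moreover have "determined n C"
    using C n by (rule determined_mono)
  ultimately have "measure cantor_measure (?B (Suc k)) =
      measure cantor_measure C * measure cantor_measure (?B k)"
    using measure_determined_Int_shift[OF _ sets] by simp
  with Suc show ?case by simp
qed

lemma initial_segment_shift:
  "initial_segment \<sigma> ((cantor_shift ^^ n) Y) \<longleftrightarrow> (\<forall>x<length \<sigma>. \<sigma> ! x = Y (n + x))"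
  by (simp add: initial_segment_def shift_funpow)

section \<open>Measure of the classes of sequences with many hits\<close>

text \<open>This is the class \<open>V\<^sub>n\<close> of the overview, for the open class generated
  by the range of \<open>p\<close>.\<close>

definition hit_class :: "(nat \<Rightarrow> bool list) \<Rightarrow> nat \<Rightarrow> nat \<Rightarrow> cantor set" where
  "hit_class p k n = (\<Union>i<k. (cantor_shift ^^ (n * Suc i)) -` open_class (range p))"

lemma mem_hit_class_iff: "Y \<in> hit_class p k n \<longleftrightarrow> (\<exists>l. hits p k n l Y)"
proof
  assume "Y \<in> hit_class p k n"
  then obtain i j where ij: "i < k" "initial_segment (p j) ((cantor_shift ^^ (n * Suc i)) Y)"
    by (auto simp: hit_class_def open_class_def)
  \<comment> \<open>The stage exceeds the index \<open>j\<close> and reaches the end of the block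
    compared with \<open>p j\<close>.\<close>
  then have "hits p k n (Suc j + length (p j) + n * Suc i) Y"
    unfolding hits_def initial_segment_shift by (intro exI[of _ i] exI[of _ j] conjI) auto
  then show "\<exists>l. hits p k n l Y" ..
next
  assume "\<exists>l. hits p k n l Y"
  then show "Y \<in> hit_class p k n"
    by (auto simp: hit_class_def open_class_def hits_def initial_segment_shift simp del: mult_Suc_right)
qed

lemma hits_mono: "hits p k n l Y \<Longrightarrow> l \<le> l' \<Longrightarrow> hits p k n l' Y"
  unfolding hits_def by (meson order_less_le_trans order_trans)

text \<open>The length condition in \<open>hits\<close> keeps every position that is read below
  \<open>l\<close>. Hence hit times and counts up to \<open>l\<close> depend on the first
  \<open>l\<close> bits only.\<close>

lemma hits_cong:
  assumes "\<And>i. i < l \<Longrightarrow> Y i = Y' i" shows "hits p k n l Y = hits p k n l Y'"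
proof -
  have "p j ! x = Y (n * Suc i + x) \<longleftrightarrow> p j ! x = Y' (n * Suc i + x)"
    if "length (p j) + n * Suc i \<le> l" "x < length (p j)" for i j x
    using assms[of "n * Suc i + x"] that by simp
  then show ?thesis unfolding hits_def by meson
qed

lemma last_hit_cong:
  assumes "\<And>i. i < l \<Longrightarrow> Y i = Y' i" shows "last_hit p k N Y l = last_hit p k N Y' l"
  using assms
proof (induction l)
  case (Suc l)
  then have "last_hit p k N Y l = last_hit p k N Y' l" by simp
  with hits_cong[of "Suc l" Y Y'] Suc.prems show ?case by simp
qed simp

lemma hit_count_cong:
  assumes "\<And>i. i < l \<Longrightarrow> Y i = Y' i" shows "hit_count p k N Y l = hit_count p k N Y' l"
  using assms
proof (induction l)
  case (Suc l)
  then have "hit_count p k N Y l = hit_count p k N Y' l" by simp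
  with last_hit_cong[of "Suc l" Y Y'] Suc.prems show ?case by (simp del: last_hit.simps)
qed simp

lemma last_hit_le: "last_hit p k N Y l \<le> l"
  by (induction l) auto

lemma hit_count_mono: "l \<le> l' \<Longrightarrow> hit_count p k N Y l \<le> hit_count p k N Y l'"
  by (induction rule: dec_induct) auto

section \<open>Sequences with at least \<open>m\<close> hits, and the time of the
  \<open>m\<close>-th hit\<close>

definition count_class :: "(nat \<Rightarrow> bool list) \<Rightarrow> nat \<Rightarrow> nat \<Rightarrow> nat \<Rightarrow> cantor set" where
  "count_class p k N m = {Y. \<exists>l. m \<le> hit_count p k N Y l}"

text \<open>The \<open>m\<close>-th hit happens at time exactly \<open>t\<close>, where the start is
  taken as the hit number 0.\<close>

definition hit_time_class :: "(nat \<Rightarrow> bool list) \<Rightarrow> nat \<Rightarrow> nat \<Rightarrow> nat \<Rightarrow> nat \<Rightarrow> cantor set" where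
  "hit_time_class p k N m t = {Y. last_hit p k N Y t = t \<and> hit_count p k N Y t = m}"

text \<open>The count up to the length of a string is the same for all its extensions, so the
  padding of \<open>code_bit\<close> has no effect. This links the decidable set of strings to the
  class whose measure is bounded.\<close>

lemma open_class_hit_count:
  "open_class {\<sigma>. m \<le> hit_count p k N (code_bit (string_code \<sigma>)) (length \<sigma>)} = count_class p k N m"
proof -
  have eq: "hit_count p k N (code_bit (string_code \<sigma>)) (length \<sigma>) = hit_count p k N Y (length \<sigma>)"
    if "initial_segment \<sigma> Y" for \<sigma> Y
    using that by (intro hit_count_cong) (simp add: initial_segment_def code_bit_string_code)
  have "initial_segment (map Y [0..<l]) Y" for Y l
    by (simp add: initial_segment_def)
  from eq[OF this] have "hit_count p k N (code_bit (string_code (map Y [0..<l]))) l = hit_count p k N Y l"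
    for Y l by simp
  note count = this
  show ?thesis
  proof (intro equalityI subsetI)
    fix Y assume "Y \<in> open_class {\<sigma>. m \<le> hit_count p k N (code_bit (string_code \<sigma>)) (length \<sigma>)}"
    then obtain \<sigma> where "m \<le> hit_count p k N (code_bit (string_code \<sigma>)) (length \<sigma>)"
      "initial_segment \<sigma> Y" unfolding open_class_def by blast
    with eq show "Y \<in> count_class p k N m" unfolding count_class_def by auto
  next
    fix Y assume "Y \<in> count_class p k N m"
    then obtain l where "m \<le> hit_count p k N Y l" unfolding count_class_def by blast
    then show "Y \<in> open_class {\<sigma>. m \<le> hit_count p k N (code_bit (string_code \<sigma>)) (length \<sigma>)}"
      using count[of Y l] unfolding open_class_def
      by (intro CollectI bexI[of _ "map Y [0..<l]"]) (simp_all add: initial_segment_def)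
  qed
qed

lemma determined_hit_time_class: "determined t (hit_time_class p k N m t)"
  unfolding determined_def
proof (intro allI impI)
  fix Y Y' assume "\<forall>i<t. Y i = Y' i" "Y \<in> hit_time_class p k N m t"
  then show "Y' \<in> hit_time_class p k N m t"
    using last_hit_cong[of t Y Y'] hit_count_cong[of t Y Y'] by (simp add: hit_time_class_def)
qed

lemma hit_count_less:
  assumes "last_hit p k N Y t' = t'" "t < t'"
  shows "hit_count p k N Y t < hit_count p k N Y t'"
proof -
  obtain u where u: "t' = Suc u" using assms(2) by (cases t') auto
  then have "hit_count p k N Y t' = Suc (hit_count p k N Y u)"
    using assms(1) by (simp del: last_hit.simps)
  moreover have "hit_count p k N Y t \<le> hit_count p k N Y u"
    using assms(2) u by (intro hit_count_mono) simp
  ultimately show ?thesis by simp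
qed

text \<open>The count increases strictly at every hit, so the \<open>m\<close>-th hit has at most
  one time.\<close>

lemma disjoint_hit_time_class: "disjoint_family (hit_time_class p k N m)"
proof -
  have "t = t'" if "Y \<in> hit_time_class p k N m t" "Y \<in> hit_time_class p k N m t'" for Y t t'
    using that hit_count_less[of p k N Y t t'] hit_count_less[of p k N Y t' t]
    unfolding hit_time_class_def by (cases t t' rule: linorder_cases) auto
  then show ?thesis unfolding disjoint_family_on_def by blast
qed

lemma hit_count_last_hit: "hit_count p k N Y (last_hit p k N Y l) = hit_count p k N Y l"
proof (induction l)
  case (Suc l)
  then show ?case using last_hit_le[of p k N Y l] by auto
qed simp

lemma last_hit_last_hit: "last_hit p k N Y (last_hit p k N Y l) = last_hit p k N Y l"
  by (induction l) auto

text \<open>The count starts at 0 and grows by at most one per stage, so it takes the value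
  \<open>m\<close> before it exceeds it. The last hit up to that stage is the
  \<open>m\<close>-th.\<close>

lemma count_class_eq: "count_class p k N m = (\<Union>t. hit_time_class p k N m t)"
proof
  show "(\<Union>t. hit_time_class p k N m t) \<subseteq> count_class p k N m"
    by (auto simp: count_class_def hit_time_class_def)
  have "\<exists>l. hit_count p k N Y l = m" if "m \<le> hit_count p k N Y l" for Y l
    using that
  proof (induction l)
    case 0
    then show ?case by (auto intro: exI[of _ 0])
  next
    case (Suc l)
    show ?case
    proof (cases "m \<le> hit_count p k N Y l")
      case False
      with Suc.prems have "hit_count p k N Y (Suc l) = m"
        by (simp del: last_hit.simps split: if_splits)
      then show ?thesis ..
    qed (rule Suc.IH)
  qed
  then have "\<exists>l. hit_count p k N Y l = m" if "Y \<in> count_class p k N m" for Y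
    using that unfolding count_class_def by blast
  moreover have "Y \<in> hit_time_class p k N (hit_count p k N Y l) (last_hit p k N Y l)" for Y l
    by (simp add: hit_time_class_def hit_count_last_hit last_hit_last_hit)
  ultimately show "count_class p k N m \<subseteq> (\<Union>t. hit_time_class p k N m t)"
    by blast
qed

lemma sets_count_class: "count_class p k N m \<in> sets cantor_measure"
  unfolding count_class_eq using sets_determined[OF determined_hit_time_class] by blast

text \<open>Between the \<open>m\<close>-th hit at time \<open>t\<close> and the next one the search
  index remains \<open>N + t\<close>. So a further hit occurs iff the sequence lies in the class
  with this index.\<close>

lemma hit_time_class_Int_count_class:
  "hit_time_class p k N m t \<inter> count_class p k N (Suc m) =
   hit_time_class p k N m t \<inter> hit_class p k (N + t)"
proof -
  have "(\<exists>l. Suc m \<le> hit_count p k N Y l) \<longleftrightarrow> (\<exists>l. hits p k (N + t) l Y)"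
    if t: "last_hit p k N Y t = t" "hit_count p k N Y t = m" for Y
  proof -
    have stay: "hit_count p k N Y l = m \<and> last_hit p k N Y l = t"
      if "t \<le> l" "\<And>i. t < i \<Longrightarrow> i \<le> l \<Longrightarrow> \<not> hits p k (N + t) i Y" for l
      using that
    proof (induction rule: dec_induct)
      case (step i)
      then show ?case by auto
    qed (use t in auto)
    show ?thesis
    proof
      assume "\<exists>l. Suc m \<le> hit_count p k N Y l"
      then obtain l where l: "Suc m \<le> hit_count p k N Y l" ..
      then have "t \<le> l" using hit_count_mono[of l t p k N Y] t by (cases "t \<le> l") auto
      then show "\<exists>l. hits p k (N + t) l Y" using stay[of l] l by fastforce
    next
      assume "\<exists>l. hits p k (N + t) l Y"
      then obtain l where "hits p k (N + t) l Y" ..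
      \<comment> \<open>A witness may be complete already at a stage \<open>l \<le> t\<close>; by
        monotonicity it is then still one at stage \<open>t + 1\<close>, the first at which it can
        be counted.\<close>
      then have ex: "t < max l (Suc t) \<and> hits p k (N + t) (max l (Suc t)) Y"
        by (auto intro: hits_mono)
      define s where "s = (LEAST i. t < i \<and> hits p k (N + t) i Y)"
      have s: "t < s" "hits p k (N + t) s Y"
        using LeastI[of "\<lambda>i. t < i \<and> hits p k (N + t) i Y", OF ex] unfolding s_def by auto
      have min: "\<not> hits p k (N + t) i Y" if "t < i" "i < s" for i
        using not_less_Least[of i] that unfolding s_def by blast
      obtain u where u: "s = Suc u" using s(1) by (cases s) auto
      have "hit_count p k N Y u = m \<and> last_hit p k N Y u = t"
        using min u s(1) by (intro stay) auto
      then have "hit_count p k N Y s = Suc m" using s u by simp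
      then show "\<exists>l. Suc m \<le> hit_count p k N Y l" by (metis order_refl)
    qed
  qed
  then show ?thesis
    unfolding hit_time_class_def count_class_def mem_hit_class_iff[abs_def] set_eq_iff Int_iff
      mem_Collect_eq mem_hit_class_iff by blast
qed

lemma count_class_Suc_subset: "count_class p k N (Suc m) \<subseteq> count_class p k N m"
  by (auto simp: count_class_def intro: Suc_leD)

text \<open>Split according to the time \<open>t\<close> of the \<open>m\<close>-th hit. This event
  is determined by the first \<open>t\<close> bits, while the next hit depends on the later bits
  only; by independence each piece shrinks by a factor of at most \<open>r\<close>.\<close>

lemma measure_count_class:
  assumes hit_le: "\<And>n. N \<le> n \<Longrightarrow> measure cantor_measure (hit_class p k n) \<le> r"
    and r: "0 \<le> r"
  shows "measure cantor_measure (count_class p k N m) \<le> r ^ m"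
proof (induction m)
  case 0
  show ?case by simp
next
  case (Suc m)
  let ?\<mu> = "measure cantor_measure" and ?A = "hit_time_class p k N m"
  have sets: "?A t \<in> sets cantor_measure" for t
    using sets_determined[OF determined_hit_time_class] .
  have le: "?\<mu> (?A t \<inter> count_class p k N (Suc m)) \<le> r * ?\<mu> (?A t)" for t
  proof -
    \<comment> \<open>The offset \<open>(N + t) * Suc i\<close> equals
      \<open>t + (N + (N + t) * i)\<close>; removing \<open>t\<close> exhibits the hit class as a
      \<open>T^-t\<close> preimage.\<close>
    define W where "W = (\<Union>i<k. (cantor_shift ^^ (N + (N + t) * i)) -` open_class (range p))"
    have W: "W \<in> sets cantor_measure"
      unfolding W_def by (intro sets.finite_UN sets_shift sets_open_class) auto
    have eq: "hit_class p k (N + t) = (cantor_shift ^^ t) -` W"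
      by (auto simp: hit_class_def W_def shift_funpow algebra_simps)
    have "?\<mu> (?A t \<inter> count_class p k N (Suc m)) = ?\<mu> (?A t) * ?\<mu> W"
      unfolding hit_time_class_Int_count_class eq
      by (rule measure_determined_Int_shift[OF determined_hit_time_class W])
    also have "?\<mu> W = ?\<mu> (hit_class p k (N + t))"
      unfolding eq by (rule measure_shift[OF W, symmetric])
    finally show ?thesis
      using mult_left_mono[OF hit_le[of "N + t"], of "?\<mu> (?A t)"] by (simp add: mult.commute)
  qed
  have "(\<lambda>t. ?\<mu> (?A t)) sums ?\<mu> (\<Union>t. ?A t)"
    using sets disjoint_hit_time_class by (intro cantor.finite_measure_UNION) auto
  then have sums1: "(\<lambda>t. r * ?\<mu> (?A t)) sums (r * ?\<mu> (count_class p k N m))"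
    unfolding count_class_eq by (rule sums_mult)
  have "disjoint_family (\<lambda>t. ?A t \<inter> count_class p k N (Suc m))"
    using disjoint_hit_time_class[of p k N m] unfolding disjoint_family_on_def by blast
  moreover have "range (\<lambda>t. ?A t \<inter> count_class p k N (Suc m)) \<subseteq> sets cantor_measure"
    using sets sets_count_class by blast
  ultimately have "(\<lambda>t. ?\<mu> (?A t \<inter> count_class p k N (Suc m))) sums
      ?\<mu> (\<Union>t. ?A t \<inter> count_class p k N (Suc m))"
    by (intro cantor.finite_measure_UNION)
  \<comment> \<open>No part is lost, since \<open>Suc m\<close> hits include an \<open>m\<close>-th
    one at some time \<open>t\<close>.\<close>
  moreover have "(\<Union>t. ?A t \<inter> count_class p k N (Suc m)) = count_class p k N (Suc m)"
    using count_class_Suc_subset[of p k N m] unfolding count_class_eq[of p k N m] by blast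
  ultimately have "(\<lambda>t. ?\<mu> (?A t \<inter> count_class p k N (Suc m))) sums ?\<mu> (count_class p k N (Suc m))"
    by simp
  from sums_le[OF le this sums1]
  have "?\<mu> (count_class p k N (Suc m)) \<le> r * ?\<mu> (count_class p k N m)" .
  also have "\<dots> \<le> r * r ^ m" using Suc r by (rule mult_left_mono)
  finally show ?case by simp
qed

section \<open>A bound below 1 on the measures of the hit classes\<close>

text \<open>For a clopen approximation the shifts by multiples of \<open>n\<close> are independent
  once \<open>n\<close> reaches its length, so all of them miss it with probability at least
  \<open>q\<close>. The open remainder is so small that its \<open>k\<close> shifts together cost at
  most \<open>q / 2\<close>.\<close>

lemma measure_hit_class_bounded:
  assumes "measure cantor_measure (open_class (range p)) < 1"
  shows "\<exists>N r. 0 \<le> r \<and> r < 1 \<and> (\<forall>n\<ge>N. measure cantor_measure (hit_class p k n) \<le> r)"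
proof -
  let ?\<mu> = "measure cantor_measure"
  define U where "U = open_class (range p)"
  define A where "A = (\<lambda>s. {Y. \<exists>j<s. length (p j) \<le> s \<and> initial_segment (p j) Y})"
  define q where "q = (1 - ?\<mu> U) ^ k"
  have q: "0 < q" "q \<le> 1"
    using assms unfolding q_def U_def by (auto intro: power_le_one)
  have det: "determined s (A s)" for s
  proof -
    have "initial_segment (p j) Y'" if "initial_segment (p j) Y" "length (p j) \<le> s" "\<forall>i<s. Y i = Y' i"
      for j Y Y' using that by (simp add: initial_segment_def)
    then show ?thesis unfolding determined_def A_def by blast
  qed
  have sets: "A s \<in> sets cantor_measure" "U \<in> sets cantor_measure" for s
    using det sets_determined sets_open_class unfolding U_def by blast+
  have AU: "A s \<subseteq> U" for s
    by (auto simp: A_def U_def open_class_def)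
  have "(\<Union>s. A s) = U"
  proof
    show "U \<subseteq> (\<Union>s. A s)"
    proof
      fix Y assume "Y \<in> U"
      then obtain j where "initial_segment (p j) Y"
        by (auto simp: U_def open_class_def)
      then have "Y \<in> A (Suc j + length (p j))"
        unfolding A_def by (auto intro!: exI[of _ j])
      then show "Y \<in> (\<Union>s. A s)" by blast
    qed
  qed (use AU in blast)
  moreover have "incseq A"
    unfolding A_def incseq_def by (auto intro: order_trans order_less_le_trans)
  ultimately have "(\<lambda>s. ?\<mu> (A s)) \<longlonglongrightarrow> ?\<mu> U"
    using cantor.finite_Lim_measure_incseq[of A] sets by auto
  \<comment> \<open>The tolerance is chosen so that \<open>k\<close> times it is at most
    \<open>q / 2\<close>; the summand 1 avoids division by zero for \<open>k = 0\<close>.\<close>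
  then have "\<forall>\<^sub>F s in sequentially. ?\<mu> U - q / (2 * (real k + 1)) < ?\<mu> (A s)"
    by (rule order_tendstoD) (use q in simp)
  then obtain N where N: "?\<mu> U - q / (2 * (real k + 1)) < ?\<mu> (A N)"
    by (auto simp: eventually_sequentially)
  have small: "?\<mu> (U - A N) \<le> q / (2 * (real k + 1))"
    using N sets AU by (simp add: cantor.finite_measure_Diff)
  have "?\<mu> (hit_class p k n) \<le> 1 - q / 2" if n: "N \<le> n" for n
  proof -
    \<comment> \<open>The multiples start at 0 here; the preimage under \<open>T^n\<close> moves
      them to \<open>n, ..., n * k\<close>.\<close>
    define B where "B = (\<Inter>i<k. (cantor_shift ^^ (n * i)) -` (- A N))"
    have detC: "determined N (- A N)"
      using det[of N] unfolding determined_def by (metis ComplD ComplI)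
    have setsB: "B \<in> sets cantor_measure"
    proof (cases "k = 0")
      case False
      then show ?thesis unfolding B_def
        by (intro sets.finite_INT sets_shift sets_determined[OF detC]) auto
    qed (simp add: B_def)
    have "q \<le> ?\<mu> (- A N) ^ k"
      unfolding q_def using cantor.prob_compl[OF sets(1)[of N]]
        cantor.finite_measure_mono[OF AU sets(2), of N]
      by (intro power_mono) (auto simp: Compl_eq_Diff_UNIV)
    also have "\<dots> = ?\<mu> B"
      unfolding B_def by (rule measure_Int_shift_multiples[OF detC n, symmetric])
    finally have qB: "q \<le> ?\<mu> ((cantor_shift ^^ n) -` B)"
      by (simp add: measure_shift[OF setsB])
    \<comment> \<open>Some shift enters \<open>U\<close> outside the approximation. These events
      need not be independent, so the union bound is used.\<close>
    define E where "E = (\<Union>i<k. (cantor_shift ^^ (n * Suc i)) -` (U - A N))"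
    have setsE: "(cantor_shift ^^ (n * Suc i)) -` (U - A N) \<in> sets cantor_measure" for i
      using sets by (intro sets_shift) auto
    have sets': "E \<in> sets cantor_measure" "- ((cantor_shift ^^ n) -` B) \<in> sets cantor_measure"
      using setsE sets.compl_sets[OF sets_shift[OF setsB, of n]]
      unfolding E_def by (auto simp: Compl_eq_Diff_UNIV simp del: mult_Suc_right)
    have "?\<mu> E \<le> (\<Sum>i<k. ?\<mu> ((cantor_shift ^^ (n * Suc i)) -` (U - A N)))"
      unfolding E_def using setsE by (intro cantor.finite_measure_subadditive_finite) auto
    also have "\<dots> = real k * ?\<mu> (U - A N)"
      using sets by (subst measure_shift) auto
    also have "\<dots> \<le> real k * (q / (2 * (real k + 1)))"
      using small by (rule mult_left_mono) simp
    also have "\<dots> \<le> q / 2"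
      using q by (simp add: field_simps)
    finally have E_le: "?\<mu> E \<le> q / 2" .
    have "hit_class p k n \<subseteq> - ((cantor_shift ^^ n) -` B) \<union> E"
    proof
      fix Y assume "Y \<in> hit_class p k n"
      then obtain i where i: "i < k" "(cantor_shift ^^ (n * Suc i)) Y \<in> U"
        by (auto simp: hit_class_def U_def simp del: mult_Suc_right)
      show "Y \<in> - ((cantor_shift ^^ n) -` B) \<union> E"
      proof (cases "(cantor_shift ^^ (n * Suc i)) Y \<in> A N")
        case True
        then have "(cantor_shift ^^ n) Y \<notin> B"
          unfolding B_def using i(1) by (auto simp: shift_funpow ac_simps)
        then show ?thesis by simp
      qed (use i in \<open>auto simp: E_def simp del: mult_Suc_right\<close>)
    qed
    then have "?\<mu> (hit_class p k n) \<le> ?\<mu> (- ((cantor_shift ^^ n) -` B) \<union> E)"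
      using sets' by (intro cantor.finite_measure_mono) auto
    also have "\<dots> \<le> ?\<mu> (- ((cantor_shift ^^ n) -` B)) + ?\<mu> E"
      using sets' by (intro measure_Un_le)
    also have "?\<mu> (- ((cantor_shift ^^ n) -` B)) = 1 - ?\<mu> ((cantor_shift ^^ n) -` B)"
      using cantor.prob_compl[OF sets_shift[OF setsB, of n]] by (simp add: Compl_eq_Diff_UNIV)
    finally show ?thesis using qB E_le by simp
  qed
  with q show ?thesis by (intro exI[of _ N] exI[of _ "1 - q / 2"]) auto
qed

section \<open>Infinitely many hits and the resulting test\<close>

text \<open>If the \<open>m\<close>-th hit is at time \<open>t\<close>, then membership in the class
  with index \<open>N + t\<close> forces another hit.\<close>

lemma mem_count_class:
  assumes "\<And>n. N \<le> n \<Longrightarrow> Z \<in> hit_class p k n"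
  shows "Z \<in> count_class p k N m"
proof (induction m)
  case 0
  show ?case by (simp add: count_class_def)
next
  case (Suc m)
  then obtain t where "Z \<in> hit_time_class p k N m t"
    unfolding count_class_eq by blast
  with assms[of "N + t"] hit_time_class_Int_count_class[of p k N m t] show ?case by auto
qed

theorem theorem5p2:
  fixes P :: "cantor set" and Z :: cantor
  assumes "pi01_class P"
    and "measure cantor_measure P > 0"
    and "martin_loef_random Z"
  shows "multiply_recurrent P Z"
proof (rule ccontr)
  assume "\<not> multiply_recurrent P Z"
  then obtain k where k: "\<And>n. 1 \<le> n \<Longrightarrow> \<exists>i\<in>{1..k}. (cantor_shift ^^ (n * i)) Z \<notin> P"
    unfolding multiply_recurrent_iff by blast
  obtain S where S: "ce_strings S" "- P = open_class S"
    using assms(1) unfolding pi01_class_def sigma01_class_def by blast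
  \<comment> \<open>Some shift of \<open>Z\<close> lies outside \<open>P\<close>; this excludes the
    empty case in the definition of \<open>comp_enum\<close> and yields an enumeration.\<close>
  have "S \<noteq> {}"
    using k[of 1] S(2) by (auto simp: open_class_def)
  then obtain f where f: "computable f" "string_code ` S = range f"
    using S(1) unfolding ce_strings_def comp_enum_def by auto
  define p where "p = (\<lambda>j. inv string_code (f j))"
  have fp: "f = (\<lambda>j. string_code (p j))"
    using bij_string_code by (simp add: p_def bij_is_surj surj_f_inv_f)
  have "range p = S"
    using f(2) bij_is_inj[OF bij_string_code] unfolding fp by (auto simp: inj_image_eq_iff simp flip: image_image)
  then have P: "P = - open_class (range p)" using S(2) by auto
  have "measure cantor_measure (open_class (range p)) < 1"
    using assms(2) cantor.prob_compl[OF sets_open_class[of "range p"]]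
    unfolding P by (simp add: Compl_eq_Diff_UNIV)
  then obtain N r where r: "0 \<le> r" "r < 1"
    and N: "\<And>n. N \<le> n \<Longrightarrow> measure cantor_measure (hit_class p k n) \<le> r"
    using measure_hit_class_bounded by blast
  \<comment> \<open>Every block of \<open>e\<close> hits at least halves the bound, so
    \<open>e * m\<close> hits bring it down to \<open>(1 / 2) ^ m\<close>.\<close>
  obtain e where e: "r ^ e < 1 / 2"
    using real_arch_pow_inv[of "1 / 2" r] r by auto
  \<comment> \<open>With \<open>Suc N\<close> even the first index searched is at least 1, as the
    failure of recurrence concerns \<open>n \<ge> 1\<close> only.\<close>
  define G where "G = (\<lambda>m. count_class p k (Suc N) (e * m))"
  have "martin_loef_test G"
    unfolding martin_loef_test_def
  proof (intro conjI exI allI)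
    show "uniformly_ce_strings
        (\<lambda>m. {\<sigma>. e * m \<le> hit_count p k (Suc N) (code_bit (string_code \<sigma>)) (length \<sigma>)})"
      by (rule uniformly_ce_hit_count) (use f(1) fp in simp)
    show "G m = open_class {\<sigma>. e * m \<le> hit_count p k (Suc N) (code_bit (string_code \<sigma>)) (length \<sigma>)}"
      for m by (simp add: G_def open_class_hit_count)
    show "measure cantor_measure (G m) \<le> (1 / 2) ^ m" for m
    proof -
      have "measure cantor_measure (G m) \<le> r ^ (e * m)"
        unfolding G_def using N r(1) by (intro measure_count_class) auto
      also have "\<dots> \<le> (1 / 2) ^ m"
        unfolding power_mult using e r(1) by (intro power_mono) auto
      finally show ?thesis .
    qed
  qed
  moreover have "Z \<in> hit_class p k n" if n: "Suc N \<le> n" for n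
  proof -
    obtain i where "i \<in> {1..k}" "(cantor_shift ^^ (n * i)) Z \<in> open_class (range p)"
      using k[of n] n P by auto
    then show ?thesis
      \<comment> \<open>The multipliers \<open>1..k\<close> are the successors of the indices below
        \<open>k\<close> in \<open>hit_class\<close>.\<close>
      unfolding hit_class_def by (cases i) auto
  qed
  then have "Z \<in> (\<Inter>m. G m)"
    unfolding G_def using mem_count_class by blast
  ultimately show False
    using assms(3) unfolding martin_loef_random_def by blast
qed

end
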